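(* Let $k\in\mathbb{N}$, $k\ge1$, let $Q_k=\{-1,1\}^k$ with weight $\mu(\chi)=2^{-k}$ for $\chi\in Q_k$, and let $\mathcal{B}^k=\mathrm{Lin}\{r_0,r_1,\ldots,r_k\}$, where $r_0\equiv1$ and $r_j(\chi)=\chi_j$ for $\chi=(\chi_1,\ldots,\chi_k)\in Q_k$, $j=1,\ldots,k$. Let $n\ge1$ and $x_1,\ldots,x_n\in Q_k$. Then the maximum likelihood estimator (MLE) for $e(\mathcal{B}^k)$ and $x_1,\ldots,x_n$ exists if and only if for all $j=1,\ldots,k$ we have $\{r_j(x_1),\ldots,r_j(x_n)\}=\{-1,1\}$.
   Context: For a finite set $\mathcal{X}$ with weight $\mu:\mathcal{X}\to(0,\infty)$ and $\phi\in\mathbb{R}^{\mathcal{X}}$ let $Z(\phi)=\sum_{x\in\mathcal{X}}e^{\phi(x)}\mu(x)$ and $e(\phi)=e^{\phi}/Z(\phi)$. For a linear subspace $\mathcal{B}\subset\mathbb{R}^{\mathcal{X}}$ let $e(\mathcal{B})=\{e(\phi):\phi\in\mathcal{B}\}$. An element $\hat p\in e(\mathcal{B})$ is the MLE for $e(\mathcal{B})$ and $x_1,\ldots,x_n\in\mathcal{X}$ if $\prod_{i=1}^n\hat p(x_i)=\sup_{p\in e(\mathcal{B})}\prod_{i=1}^n p(x_i)$. *)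

theory Defs
  imports "HOL-Analysis.Analysis" "HOL-Library.Function_Algebras"
begin

text \<open>
  For a finite set \<open>X\<close>, an element of \<open>\<real>\<^sup>X\<close> is represented by a function on the surrounding type
  that vanishes outside \<open>X\<close>. These functions form a linear subspace of the space of all
  real-valued functions, in which the linear span is taken with pointwise operations.
\<close>

abbreviation fun_scale :: "real \<Rightarrow> ('a \<Rightarrow> real) \<Rightarrow> 'a \<Rightarrow> real" where
  "fun_scale c f \<equiv> (\<lambda>x. c * f x)"

interpretation fun_space: vector_space "fun_scale :: real \<Rightarrow> ('a \<Rightarrow> real) \<Rightarrow> 'a \<Rightarrow> real"
  by unfold_locales (auto simp: fun_eq_iff algebra_simps)

definition Lin :: "('a \<Rightarrow> real) set \<Rightarrow> ('a \<Rightarrow> real) set" where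
  "Lin S = module.span fun_scale S"

definition partition_fun :: "'a set \<Rightarrow> ('a \<Rightarrow> real) \<Rightarrow> ('a \<Rightarrow> real) \<Rightarrow> real" where
  "partition_fun X \<mu> \<phi> = (\<Sum>x\<in>X. exp (\<phi> x) * \<mu> x)"

definition exp_density :: "'a set \<Rightarrow> ('a \<Rightarrow> real) \<Rightarrow> ('a \<Rightarrow> real) \<Rightarrow> 'a \<Rightarrow> real" where
  "exp_density X \<mu> \<phi> = (\<lambda>x. if x \<in> X then exp (\<phi> x) / partition_fun X \<mu> \<phi> else 0)"

definition exp_family :: "'a set \<Rightarrow> ('a \<Rightarrow> real) \<Rightarrow> ('a \<Rightarrow> real) set \<Rightarrow> ('a \<Rightarrow> real) set" where
  "exp_family X \<mu> B = exp_density X \<mu> ` B"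

text \<open>
  The sample is \<open>x 1, \<dots>, x n\<close>; other values of \<open>x\<close> are irrelevant. The supremum is a genuine
  real supremum whenever \<open>X\<close> is finite, \<open>\<mu>\<close> is positive on \<open>X\<close>, \<open>B\<close> is nonempty and the sample
  lies in \<open>X\<close>: every density \<open>p\<close> then satisfies \<open>0 < p y \<le> 1 / \<mu> y\<close> for \<open>y\<close> in \<open>X\<close>.
\<close>

definition is_MLE ::
  "'a set \<Rightarrow> ('a \<Rightarrow> real) \<Rightarrow> ('a \<Rightarrow> real) set \<Rightarrow> nat \<Rightarrow> (nat \<Rightarrow> 'a) \<Rightarrow> ('a \<Rightarrow> real) \<Rightarrow> bool" where
  "is_MLE X \<mu> B n x q \<longleftrightarrow>
     q \<in> exp_family X \<mu> B \<and>
     (\<Prod>i=1..n. q (x i)) = (SUP p\<in>exp_family X \<mu> B. \<Prod>i=1..n. p (x i))"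

text \<open>A point of \<open>{-1,1}\<^sup>k\<close> is a function on \<open>{1..k}\<close>, extensional outside that index set.\<close>

definition cube :: "nat \<Rightarrow> (nat \<Rightarrow> real) set" where
  "cube k = {1..k} \<rightarrow>\<^sub>E {-1, 1}"

definition cube_weight :: "nat \<Rightarrow> (nat \<Rightarrow> real) \<Rightarrow> real" where
  "cube_weight k = (\<lambda>y. 1 / 2 ^ k)"

definition rademacher :: "nat \<Rightarrow> nat \<Rightarrow> (nat \<Rightarrow> real) \<Rightarrow> real" where
  "rademacher k j = (\<lambda>y. if y \<in> cube k then (if j = 0 then 1 else y j) else 0)"

definition rademacher_space :: "nat \<Rightarrow> ((nat \<Rightarrow> real) \<Rightarrow> real) set" where
  "rademacher_space k = Lin (rademacher k ` {0..k})"

end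

theory Submission
  imports Defs
begin

text \<open>
  The family \<open>e(\<B>\<^sup>k)\<close> consists of the product densities on the cube. Indeed, for \<open>y = \<plusminus>1\<close> one has
  \<open>exp (a y) = cosh a (1 + y tanh a)\<close>, and the partition function of \<open>a\<^sub>0 + \<Sum>\<^sub>j a\<^sub>j r\<^sub>j\<close> factorizes as
  \<open>exp a\<^sub>0 \<Prod>\<^sub>j cosh a\<^sub>j\<close>; so the density is \<open>\<Prod>\<^sub>j (1 + t\<^sub>j y\<^sub>j)\<close> with \<open>t\<^sub>j = tanh a\<^sub>j\<close>, and the
  vector \<open>t\<close> ranges over the whole open cube \<open>(-1,1)\<^sup>k\<close> (\<open>exp_family_rademacher\<close>).

  Consequently the likelihood splits into \<open>k\<close> independent one-parameter problems: maximize
  \<open>L\<^sub>j(t) = \<Prod>\<^sub>i (1 + t r\<^sub>j(x\<^sub>i))\<close> over \<open>-1 < t < 1\<close>. If both signs occur among the \<open>r\<^sub>j(x\<^sub>i)\<close>, then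
  \<open>L\<^sub>j\<close> is continuous on \<open>[-1,1]\<close> and vanishes at both ends, so its maximum is attained inside
  (\<open>sign_likelihood_has_max\<close>), and the coordinatewise maximizers give an MLE. If only one sign
  \<open>s\<close> occurs in some coordinate, then \<open>L\<^sub>j\<close> strictly increases as \<open>t\<close> moves towards \<open>s\<close>, which lies
  outside the parameter domain, so no density attains the supremum (\<open>biased_maximum_iff\<close>).
\<close>

text \<open>
  The supremum over an unbounded set of reals is an unspecified number; boundedness makes it an
  upper bound, so that attaining it means being maximal.
\<close>

lemma is_MLE_iff_maximum:
  assumes "bdd_above ((\<lambda>p. \<Prod>i=1..n. p (x i)) ` exp_family X \<mu> B)"
  shows "is_MLE X \<mu> B n x q \<longleftrightarrow>
    q \<in> exp_family X \<mu> B \<and>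
    (\<forall>p\<in>exp_family X \<mu> B. (\<Prod>i=1..n. p (x i)) \<le> (\<Prod>i=1..n. q (x i)))"
    (is "_ \<longleftrightarrow> _ \<and> ?max")
proof (cases "q \<in> exp_family X \<mu> B")
  case True
  have "(\<Prod>i=1..n. q (x i)) = (SUP p\<in>exp_family X \<mu> B. \<Prod>i=1..n. p (x i)) \<longleftrightarrow> ?max"
  proof
    assume eq: "(\<Prod>i=1..n. q (x i)) = (SUP p\<in>exp_family X \<mu> B. \<Prod>i=1..n. p (x i))"
    show ?max
      unfolding eq by (intro ballI cSUP_upper assms)
  next
    assume ?max
    then show "(\<Prod>i=1..n. q (x i)) = (SUP p\<in>exp_family X \<mu> B. \<Prod>i=1..n. p (x i))"
      by (intro cSup_eq_maximum[symmetric]) (use True in auto)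
  qed
  with True show ?thesis
    by (simp add: is_MLE_def)
qed (simp add: is_MLE_def)

lemma sum_of_functions_apply:
  fixes f :: "'i \<Rightarrow> 'a \<Rightarrow> 'b::comm_monoid_add"
  shows "(\<Sum>i\<in>I. f i) y = (\<Sum>i\<in>I. f i y)"
  by (induction I rule: infinite_finite_induct) auto

lemma rademacher_space_eq:
  "rademacher_space k = range (\<lambda>a y. \<Sum>j\<in>{0..k}. a j * rademacher k j y)"
    (is "_ = range ?comb")
proof
  show "rademacher_space k \<subseteq> range ?comb"
  proof
    fix \<phi>
    assume "\<phi> \<in> rademacher_space k"
    then have "\<phi> \<in> fun_space.span (rademacher k ` {0..k})"
      by (simp add: rademacher_space_def Lin_def)
    then show "\<phi> \<in> range ?comb"
    proof (induction rule: fun_space.span_induct_alt)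
      case base
      have "0 = ?comb (\<lambda>_. 0)"
        by (simp add: fun_eq_iff)
      then show ?case
        by (rule range_eqI[where x = "\<lambda>_. 0"])
    next
      case (step c \<psi> \<phi>)
      then obtain m a where "m \<le> k" "\<psi> = rademacher k m" "\<phi> = ?comb a"
        by auto
      moreover have "(\<Sum>j\<in>{0..k}. (a j + (if j = m then c else 0)) * rademacher k j y)
          = ?comb a y + c * rademacher k m y" if "m \<le> k" for y
        using that by (simp add: distrib_right sum.distrib if_distrib[of "\<lambda>u. u * _"] cong: if_cong)
      ultimately have "fun_scale c \<psi> + \<phi> = ?comb (\<lambda>j. a j + (if j = m then c else 0))"
        by (simp add: fun_eq_iff)
      then show ?case
        by (rule range_eqI[where x = "\<lambda>j. a j + (if j = m then c else 0)"])
    qed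
  qed
next
  have "?comb a \<in> fun_space.span (rademacher k ` {0..k})" for a
  proof -
    have "?comb a = (\<Sum>j\<in>{0..k}. fun_scale (a j) (rademacher k j))"
      by (simp add: fun_eq_iff sum_of_functions_apply)
    also have "\<dots> \<in> fun_space.span (rademacher k ` {0..k})"
      by (intro fun_space.span_sum fun_space.span_scale fun_space.span_base) auto
    finally show ?thesis .
  qed
  then show "range ?comb \<subseteq> rademacher_space k"
    by (auto simp: rademacher_space_def Lin_def)
qed

lemma cube_coordinate:
  assumes "y \<in> cube k" "j \<in> {1..k}"
  shows "y j = -1 \<or> y j = 1"
  using assms by (auto simp: cube_def PiE_iff)

text \<open>
  The density, relative to the uniform weight, of independent signs with means \<open>t\<^sub>j\<close>.
\<close>

definition biased_density :: "nat \<Rightarrow> (nat \<Rightarrow> real) \<Rightarrow> (nat \<Rightarrow> real) \<Rightarrow> real" where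
  "biased_density k t = (\<lambda>y. if y \<in> cube k then \<Prod>j\<in>{1..k}. 1 + t j * y j else 0)"

lemma exp_sign_eq:
  fixes a s :: real
  assumes "s = -1 \<or> s = 1"
  shows "exp (a * s) = cosh a * (1 + tanh a * s)"
  using assms
proof
  assume "s = -1"
  then show ?thesis
    by (simp add: tanh_def right_diff_distrib cosh_minus_sinh)
next
  assume "s = 1"
  then show ?thesis
    by (simp add: tanh_def distrib_left cosh_plus_sinh)
qed

lemma exp_rademacher_comb:
  assumes "y \<in> cube k"
  shows "exp (\<Sum>j\<in>{0..k}. a j * rademacher k j y)
    = exp (a 0) * (\<Prod>j\<in>{1..k}. exp (a j * y j))"
proof -
  have "(\<Sum>j\<in>{0..k}. a j * rademacher k j y) = a 0 + (\<Sum>j\<in>{1..k}. a j * y j)"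
    using assms by (simp add: sum.atLeast_Suc_atMost rademacher_def)
  then show ?thesis
    by (simp add: exp_add exp_sum)
qed

text \<open>Summing a product of one-coordinate functions over the cube gives the product of the sums.\<close>

lemma partition_fun_rademacher:
  "partition_fun (cube k) (cube_weight k) (\<lambda>y. \<Sum>j\<in>{0..k}. a j * rademacher k j y)
    = exp (a 0) * (\<Prod>j\<in>{1..k}. cosh (a j))"
proof -
  have "partition_fun (cube k) (cube_weight k) (\<lambda>y. \<Sum>j\<in>{0..k}. a j * rademacher k j y)
      = (\<Sum>y\<in>cube k. exp (a 0) / 2 ^ k * (\<Prod>j\<in>{1..k}. exp (a j * y j)))"
    unfolding partition_fun_def
    by (intro sum.cong refl) (simp add: exp_rademacher_comb cube_weight_def)
  also have "\<dots> = exp (a 0) / 2 ^ k * (\<Sum>y\<in>cube k. \<Prod>j\<in>{1..k}. exp (a j * y j))"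
    by (simp add: sum_distrib_left)
  also have "(\<Sum>y\<in>cube k. \<Prod>j\<in>{1..k}. exp (a j * y j))
      = (\<Prod>j\<in>{1..k}. \<Sum>s\<in>{-1, 1}. exp (a j * s))"
    unfolding cube_def by (rule prod_sum_PiE[symmetric]) auto
  also have "\<dots> = (\<Prod>j\<in>{1..k}. 2 * cosh (a j))"
    by (intro prod.cong) (auto simp: cosh_def)
  also have "\<dots> = 2 ^ k * (\<Prod>j\<in>{1..k}. cosh (a j))"
    by (simp add: prod.distrib)
  finally show ?thesis
    by simp
qed

lemma exp_density_rademacher:
  "exp_density (cube k) (cube_weight k) (\<lambda>y. \<Sum>j\<in>{0..k}. a j * rademacher k j y)
    = biased_density k (\<lambda>j. tanh (a j))"
proof
  fix y
  show "exp_density (cube k) (cube_weight k) (\<lambda>y. \<Sum>j\<in>{0..k}. a j * rademacher k j y) y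
    = biased_density k (\<lambda>j. tanh (a j)) y"
  proof (cases "y \<in> cube k")
    case True
    have "(\<Prod>j\<in>{1..k}. exp (a j * y j)) = (\<Prod>j\<in>{1..k}. cosh (a j) * (1 + tanh (a j) * y j))"
      by (intro prod.cong refl exp_sign_eq cube_coordinate[OF True])
    then have "exp (\<Sum>j\<in>{0..k}. a j * rademacher k j y)
        = exp (a 0) * (\<Prod>j\<in>{1..k}. cosh (a j)) * (\<Prod>j\<in>{1..k}. 1 + tanh (a j) * y j)"
      using True by (simp add: exp_rademacher_comb prod.distrib)
    moreover have "(\<Prod>j\<in>{1..k}. cosh (a j)) \<noteq> 0"
      by simp
    ultimately show ?thesis
      using True by (simp add: exp_density_def biased_density_def partition_fun_rademacher)
  qed (simp add: exp_density_def biased_density_def)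
qed

lemma tanh_surj_on_unit_interval:
  fixes t :: real
  assumes "\<bar>t\<bar> < 1"
  obtains a where "tanh a = t"
proof
  let ?a = "- ln ((1 - t) / (1 + t)) / 2"
  have "exp (-2 * ?a) = (1 - t) / (1 + t)"
    using assms by (simp add: abs_less_iff)
  then have "tanh ?a = (1 - (1 - t) / (1 + t)) / (1 + (1 - t) / (1 + t))"
    by (simp only: tanh_real_altdef)
  also have "\<dots> = t"
    using assms by (simp add: divide_simps abs_less_iff)
  finally show "tanh ?a = t" .
qed

text \<open>
  The coefficient of \<open>r\<^sub>0\<close> cancels in the normalization, and \<open>tanh\<close> is a reparametrization of
  the remaining coefficients by means in the open interval \<open>(-1,1)\<close>.
\<close>

lemma exp_family_rademacher:
  "exp_family (cube k) (cube_weight k) (rademacher_space k)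
    = biased_density k ` {t. \<forall>j. \<bar>t j\<bar> < 1}"
proof -
  have "range (\<lambda>a j. tanh (a j)) = {t :: nat \<Rightarrow> real. \<forall>j. \<bar>t j\<bar> < 1}" (is "?L = ?R")
  proof
    show "?L \<subseteq> ?R"
      by (auto simp: abs_less_iff tanh_real_lt_1 tanh_real_gt_neg1 minus_less_iff)
    show "?R \<subseteq> ?L"
    proof
      fix t :: "nat \<Rightarrow> real"
      assume "t \<in> ?R"
      then have "\<forall>j. \<exists>a. tanh a = t j"
        by (metis mem_Collect_eq tanh_surj_on_unit_interval)
      then obtain a where "\<forall>j. tanh (a j) = t j"
        by metis
      then have "t = (\<lambda>j. tanh (a j))"
        by auto
      then show "t \<in> ?L"
        by blast
    qed
  qed
  moreover have "exp_family (cube k) (cube_weight k) (rademacher_space k)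
      = biased_density k ` range (\<lambda>a j. tanh (a j))"
    by (simp add: exp_family_def rademacher_space_eq image_image exp_density_rademacher)
  ultimately show ?thesis
    by simp
qed

lemma sign_factor_pos:
  fixes t s :: real
  assumes "\<bar>t\<bar> < 1" "s = -1 \<or> s = 1"
  shows "0 < 1 + t * s"
  using assms by auto

lemma biased_likelihood_eq:
  assumes "\<forall>i\<in>{1..n}. x i \<in> cube k"
  shows "(\<Prod>i=1..n. biased_density k t (x i)) = (\<Prod>j\<in>{1..k}. \<Prod>i=1..n. 1 + t j * x i j)"
proof -
  have "(\<Prod>i=1..n. biased_density k t (x i)) = (\<Prod>i=1..n. \<Prod>j\<in>{1..k}. 1 + t j * x i j)"
    using assms by (intro prod.cong) (auto simp: biased_density_def)
  then show ?thesis
    by (simp add: prod.swap[of _ "{1..n}"])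
qed

lemma bdd_above_biased_likelihood:
  assumes x: "\<forall>i\<in>{1..n}. x i \<in> cube k"
  shows "bdd_above ((\<lambda>p. \<Prod>i=1..n. p (x i)) ` biased_density k ` {t. \<forall>j. \<bar>t j\<bar> < 1})"
proof -
  have "(\<Prod>i=1..n. biased_density k t (x i)) \<le> (\<Prod>j\<in>{1..k}. \<Prod>i=1..n. (2::real))"
    if t: "\<forall>j. \<bar>t j\<bar> < 1" for t
    unfolding biased_likelihood_eq[OF x]
  proof (intro prod_mono conjI prod_nonneg)
    fix j i
    assume "j \<in> {1..k}" "i \<in> {1..n}"
    then have "x i j = -1 \<or> x i j = 1"
      using x cube_coordinate by blast
    moreover have "\<bar>t j\<bar> < 1"
      using t by blast
    ultimately show "0 \<le> 1 + t j * x i j" "0 \<le> 1 + t j * x i j" "1 + t j * x i j \<le> 2"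
      by auto
  qed
  then show ?thesis
    by (auto intro!: bdd_aboveI)
qed

text \<open>
  The product is a polynomial in \<open>t\<close> that equals \<open>1\<close> at \<open>t = 0\<close> and vanishes at \<open>t = \<plusminus>1\<close> because
  both signs occur; so its maximum over the compact interval lies in the interior.
\<close>

lemma sign_likelihood_has_max:
  fixes s :: "'i \<Rightarrow> real"
  assumes "finite I" "i \<in> I" "s i = 1" "i' \<in> I" "s i' = -1"
  obtains t where "\<bar>t\<bar> < 1"
    and "\<And>u. \<bar>u\<bar> < 1 \<Longrightarrow> (\<Prod>i\<in>I. 1 + u * s i) \<le> (\<Prod>i\<in>I. 1 + t * s i)"
proof -
  let ?L = "\<lambda>t. \<Prod>i\<in>I. 1 + t * s i"
  have "continuous_on {-1..1} ?L"
    by (intro continuous_intros)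
  then obtain t where t: "t \<in> {-1..1}" and max: "\<And>u. u \<in> {-1..1} \<Longrightarrow> ?L u \<le> ?L t"
    using continuous_attains_sup[of "{-1..1::real}" ?L] by auto
  have "?L 1 = 0" "?L (-1) = 0"
    using assms by (auto simp: prod_zero_iff intro: bexI[of _ i] bexI[of _ i'])
  moreover have "1 \<le> ?L t"
    using max[of 0] by simp
  ultimately have "t \<noteq> 1" "t \<noteq> -1"
    by auto
  with t have "\<bar>t\<bar> < 1"
    by auto
  moreover have "?L u \<le> ?L t" if "\<bar>u\<bar> < 1" for u
    using that by (intro max) auto
  ultimately show thesis
    by (rule that)
qed

text \<open>
  Replacing \<open>t\<close> by the midpoint \<open>(t + s) / 2\<close> stays in the open interval and increases every factor.
\<close>

lemma constant_sign_likelihood_no_max: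
  fixes s t :: real
  assumes "n \<ge> (1::nat)" "\<bar>t\<bar> < 1" "s = -1 \<or> s = 1"
  obtains u where "\<bar>u\<bar> < 1" "(1 + t * s) ^ n < (1 + u * s) ^ n"
proof
  let ?u = "(t + s) / 2"
  show "\<bar>?u\<bar> < 1"
    using assms by auto
  have "1 + t * s < 1 + ?u * s"
    using assms by auto
  then show "(1 + t * s) ^ n < (1 + ?u * s) ^ n"
    using assms sign_factor_pos[OF assms(2,3)] by (intro power_strict_mono) auto
qed

text \<open>
  All factors of the likelihood are positive, so it increases when a single coordinate factor does,
  and it is maximal as soon as every coordinate factor is.
\<close>

lemma biased_maximum_iff:
  fixes n k :: nat and x :: "nat \<Rightarrow> nat \<Rightarrow> real"
  assumes n: "n \<ge> 1" and x: "\<forall>i\<in>{1..n}. x i \<in> cube k"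
  shows "(\<exists>t. (\<forall>j. \<bar>t j\<bar> < 1) \<and> (\<forall>u. (\<forall>j. \<bar>u j\<bar> < 1) \<longrightarrow>
      (\<Prod>j\<in>{1..k}. \<Prod>i=1..n. 1 + u j * x i j) \<le> (\<Prod>j\<in>{1..k}. \<Prod>i=1..n. 1 + t j * x i j)))
    \<longleftrightarrow> (\<forall>j\<in>{1..k}. (\<lambda>i. x i j) ` {1..n} = {-1, 1})"
    (is "(\<exists>t. ?adm t \<and> (\<forall>u. ?adm u \<longrightarrow> ?lik u \<le> ?lik t)) \<longleftrightarrow> _")
proof
  assume "\<exists>t. ?adm t \<and> (\<forall>u. ?adm u \<longrightarrow> ?lik u \<le> ?lik t)"
  then obtain t where t: "?adm t" and max: "\<And>u. ?adm u \<Longrightarrow> ?lik u \<le> ?lik t"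
    by blast
  show "\<forall>j\<in>{1..k}. (\<lambda>i. x i j) ` {1..n} = {-1, 1}"
  proof (rule ccontr)
    assume "\<not> (\<forall>j\<in>{1..k}. (\<lambda>i. x i j) ` {1..n} = {-1, 1})"
    then obtain m where m: "m \<in> {1..k}" and ne: "(\<lambda>i. x i m) ` {1..n} \<noteq> {-1, 1}"
      by blast
    have sign: "x i m = -1 \<or> x i m = 1" if "i \<in> {1..n}" for i
      using that x m cube_coordinate by blast
    have "\<exists>s. (s = -1 \<or> s = 1) \<and> (\<forall>i\<in>{1..n}. x i m = s)"
    proof (rule ccontr)
      assume "\<not> ?thesis"
      then obtain i i' where "i \<in> {1..n}" "x i m \<noteq> 1" "i' \<in> {1..n}" "x i' m \<noteq> -1"
        by blast
      then have "-1 \<in> (\<lambda>i. x i m) ` {1..n}" "1 \<in> (\<lambda>i. x i m) ` {1..n}"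
        using sign by (metis image_eqI)+
      moreover have "(\<lambda>i. x i m) ` {1..n} \<subseteq> {-1, 1}"
        using sign by blast
      ultimately show False
        using ne by blast
    qed
    then obtain s where s: "s = -1 \<or> s = 1" and const: "\<forall>i\<in>{1..n}. x i m = s"
      by blast
    obtain v where v: "\<bar>v\<bar> < 1" "(1 + t m * s) ^ n < (1 + v * s) ^ n"
      using constant_sign_likelihood_no_max n t s by metis
    have lik_upd: "?lik (t(m := w)) =
        (1 + w * s) ^ n * (\<Prod>j\<in>{1..k} - {m}. \<Prod>i=1..n. 1 + t j * x i j)" for w
    proof -
      have "?lik (t(m := w)) = (\<Prod>i=1..n. 1 + w * x i m)
          * (\<Prod>j\<in>{1..k} - {m}. \<Prod>i=1..n. 1 + (t(m := w)) j * x i j)"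
        using m by (subst prod.remove[of _ m]) auto
      also have "(\<Prod>i=1..n. 1 + w * x i m) = (1 + w * s) ^ n"
        using const by simp
      also have "(\<Prod>j\<in>{1..k} - {m}. \<Prod>i=1..n. 1 + (t(m := w)) j * x i j)
          = (\<Prod>j\<in>{1..k} - {m}. \<Prod>i=1..n. 1 + t j * x i j)"
        by (intro prod.cong) auto
      finally show ?thesis .
    qed
    have "0 < (\<Prod>j\<in>{1..k} - {m}. \<Prod>i=1..n. 1 + t j * x i j)"
    proof (intro prod_pos ballI)
      fix j i
      assume "j \<in> {1..k} - {m}" "i \<in> {1..n}"
      then show "0 < 1 + t j * x i j"
        using t x cube_coordinate by (intro sign_factor_pos) blast+
    qed
    then have "?lik (t(m := t m)) < ?lik (t(m := v))"
      unfolding lik_upd using v by simp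
    moreover have "?lik (t(m := v)) \<le> ?lik t"
      using t v by (intro max) auto
    ultimately show False
      by simp
  qed
next
  assume both: "\<forall>j\<in>{1..k}. (\<lambda>i. x i j) ` {1..n} = {-1, 1}"
  have "\<exists>t. \<bar>t\<bar> < 1 \<and> (j \<in> {1..k} \<longrightarrow>
      (\<forall>u. \<bar>u\<bar> < 1 \<longrightarrow> (\<Prod>i=1..n. 1 + u * x i j) \<le> (\<Prod>i=1..n. 1 + t * x i j)))" for j
  proof (cases "j \<in> {1..k}")
    case True
    then have "1 \<in> (\<lambda>i. x i j) ` {1..n}" "-1 \<in> (\<lambda>i. x i j) ` {1..n}"
      using both by auto
    then obtain i i' where "i \<in> {1..n}" "x i j = 1" "i' \<in> {1..n}" "x i' j = -1"
      by force
    then show ?thesis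
      using sign_likelihood_has_max[of "{1..n}" i "\<lambda>i. x i j" i'] by (metis finite_atLeastAtMost)
  qed (auto intro: exI[of _ 0])
  then obtain t where t: "\<And>j. \<bar>t j\<bar> < 1" and max: "\<And>j u. j \<in> {1..k} \<Longrightarrow> \<bar>u\<bar> < 1 \<Longrightarrow>
      (\<Prod>i=1..n. 1 + u * x i j) \<le> (\<Prod>i=1..n. 1 + t j * x i j)"
    by metis
  have "?lik u \<le> ?lik t" if u: "?adm u" for u
  proof (rule prod_mono)
    fix j
    assume j: "j \<in> {1..k}"
    have "0 \<le> 1 + u j * x i j" if "i \<in> {1..n}" for i
      using that u x j cube_coordinate by (intro less_imp_le sign_factor_pos) blast+
    moreover have "(\<Prod>i=1..n. 1 + u j * x i j) \<le> (\<Prod>i=1..n. 1 + t j * x i j)"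
      using j u by (intro max) auto
    ultimately show "0 \<le> (\<Prod>i=1..n. 1 + u j * x i j)
        \<and> (\<Prod>i=1..n. 1 + u j * x i j) \<le> (\<Prod>i=1..n. 1 + t j * x i j)"
      by (intro conjI prod_nonneg) auto
  qed
  with t show "\<exists>t. ?adm t \<and> (\<forall>u. ?adm u \<longrightarrow> ?lik u \<le> ?lik t)"
    by blast
qed

theorem theorem3p5:
  fixes k n :: nat and x :: "nat \<Rightarrow> nat \<Rightarrow> real"
  assumes "k \<ge> 1" and "n \<ge> 1"
    and "\<And>i. i \<in> {1..n} \<Longrightarrow> x i \<in> cube k"
  shows "(\<exists>q. is_MLE (cube k) (cube_weight k) (rademacher_space k) n x q) \<longleftrightarrow>
         (\<forall>j\<in>{1..k}. (\<lambda>i. rademacher k j (x i)) ` {1..n} = {-1, 1})"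
proof -
  have x: "\<forall>i\<in>{1..n}. x i \<in> cube k"
    using assms(3) by blast
  have "(\<exists>q. is_MLE (cube k) (cube_weight k) (rademacher_space k) n x q) \<longleftrightarrow>
      (\<exists>q \<in> biased_density k ` {t. \<forall>j. \<bar>t j\<bar> < 1}. \<forall>p \<in> biased_density k ` {t. \<forall>j. \<bar>t j\<bar> < 1}.
        (\<Prod>i=1..n. p (x i)) \<le> (\<Prod>i=1..n. q (x i)))"
    using bdd_above_biased_likelihood[OF x]
    by (subst is_MLE_iff_maximum) (simp_all only: exp_family_rademacher Bex_def)
  also have "\<dots> \<longleftrightarrow> (\<exists>t. (\<forall>j. \<bar>t j\<bar> < 1) \<and> (\<forall>u. (\<forall>j. \<bar>u j\<bar> < 1) \<longrightarrow>
      (\<Prod>j\<in>{1..k}. \<Prod>i=1..n. 1 + u j * x i j) \<le> (\<Prod>j\<in>{1..k}. \<Prod>i=1..n. 1 + t j * x i j)))"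
    by (simp only: bex_simps ball_simps biased_likelihood_eq[OF x])
  also have "\<dots> \<longleftrightarrow> (\<forall>j\<in>{1..k}. (\<lambda>i. x i j) ` {1..n} = {-1, 1})"
    by (rule biased_maximum_iff[OF assms(2) x])
  also have "\<dots> \<longleftrightarrow> (\<forall>j\<in>{1..k}. (\<lambda>i. rademacher k j (x i)) ` {1..n} = {-1, 1})"
  proof (intro ball_cong refl)
    fix j
    assume "j \<in> {1..k}"
    then have "(\<lambda>i. x i j) ` {1..n} = (\<lambda>i. rademacher k j (x i)) ` {1..n}"
      using x by (intro image_cong) (auto simp: rademacher_def)
    then show "((\<lambda>i. x i j) ` {1..n} = {-1, 1})
        = ((\<lambda>i. rademacher k j (x i)) ` {1..n} = {-1, 1})"
      by simp
  qed
  finally show ?thesis .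
qed

end
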